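(* Let $G^{\rm B}$ be the point symmetry group of the Burgers equation $v_t+vv_x=v_{xx}$ and $\mathfrak g^{\rm B}$ its Lie algebra. The transformation $\breve{\mathscr J}\colon(t,x,v)\mapsto(t,-x,-v)$ belongs to $G^{\rm B}$ and satisfies $$\breve{\mathscr J}\big(G^{\rm B}\setminus\exp(\mathfrak g^{\rm B})\big)\subseteq\exp(\mathfrak g^{\rm B}),$$ i.e., this transformation is a pseudo-discrete element of $G^{\rm B}$ or, equivalently, a pseudo-discrete point symmetry of the Burgers equation.
   Context: Given a Lie group $G$ with Lie algebra $\mathfrak g$ and identity component $G_{\rm id}$ such that $\exp(\mathfrak g)\ne G_{\rm id}$, an element $g\in G$ is called pseudo-discrete if $g\big(G_{\rm id}\setminus\exp(\mathfrak g)\big)\subseteq\exp(\mathfrak g)$. Pseudo-discrete elements of the point symmetry group of a system of differential equations are called pseudo-discrete point symmetries of this system. $G^{\rm B}$ is the (connected) Lie group of transformations $$\tilde t=\frac{\alpha t+\beta}{\gamma t+\delta},\quad \tilde x=\frac{x+\lambda_1t+\lambda_0}{\gamma t+\delta},\quad \tilde v=(\gamma t+\delta)v-\gamma x+\lambda_1\delta-\lambda_0\gamma,$$ with real parameters and $\alpha\delta-\beta\gamma=1$, each considered on its natural domain $\{\gamma t+\delta\ne0\}$. The multiplication is the modified composition: the product of $\Phi_1$ and $\Phi_2$ is the transformation of this form that has the same parameters as the usual composition $\Phi_1\circ\Phi_2$ and is considered on its natural domain. The Lie algebra $\mathfrak g^{\rm B}$ is spanned by $\partial_t$, $2t\partial_t+x\partial_x-v\partial_v$,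 $t^2\partial_t+tx\partial_x+(x-tv)\partial_v$, $\partial_x$, $t\partial_x+\partial_v$. *)

theory Defs
  imports "HOL-Analysis.Analysis" "HOL-Algebra.Coset"
begin

section \<open>Groups of partial transformations\<close>

text \<open>
  Points are triples \<open>(t, x, v)\<close>.  A transformation is a partial map of the space of points,
  defined on its domain.
\<close>

type_synonym point = "real \<times> real \<times> real"
type_synonym transformation = "point \<rightharpoonup> point"

definition one_parameter_subgroup ::
    "('a, 'b) monoid_scheme \<Rightarrow> 'a topology \<Rightarrow> (real \<Rightarrow> 'a) \<Rightarrow> bool" where
  "one_parameter_subgroup G T \<phi> \<longleftrightarrow>
     continuous_map euclideanreal T \<phi> \<and> (\<forall>r s. \<phi> (r + s) = \<phi> r \<otimes>\<^bsub>G\<^esub> \<phi> s)"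

definition generated_by :: "(real \<Rightarrow> transformation) \<Rightarrow> (point \<Rightarrow> point) \<Rightarrow> bool" where
  "generated_by \<phi> Q \<longleftrightarrow>
     (\<forall>z. (\<forall>\<^sub>F s in nhds 0. z \<in> dom (\<phi> s)) \<and>
          ((\<lambda>s. the (\<phi> s z)) has_vector_derivative Q z) (at 0))"

text \<open>
  For a Lie group \<open>G\<close> of transformations with group topology \<open>T\<close> and Lie algebra \<open>L\<close> of vector
  fields, the following set is \<open>exp(L)\<close>: the exponential of \<open>Q \<in> L\<close> is the value at time \<open>1\<close>
  of the one-parameter subgroup of \<open>G\<close> with infinitesimal generator \<open>Q\<close>.  (Continuous
  one-parameter subgroups of a Lie group are automatically smooth.)
\<close>

definition exp_image ::
    "(transformation, 'b) monoid_scheme \<Rightarrow> transformation topology \<Rightarrow> (point \<Rightarrow> point) set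
       \<Rightarrow> transformation set" where
  "exp_image G T L =
     {\<phi> 1 | \<phi> Q. Q \<in> L \<and> one_parameter_subgroup G T \<phi> \<and> generated_by \<phi> Q}"

definition identity_component :: "('a, 'b) monoid_scheme \<Rightarrow> 'a topology \<Rightarrow> 'a set" where
  "identity_component G T = connected_component_of_set T \<one>\<^bsub>G\<^esub>"

text \<open>Here \<open>E\<close> stands for the image of the Lie algebra under the exponential map.\<close>

definition pseudo_discrete ::
    "('a, 'b) monoid_scheme \<Rightarrow> 'a topology \<Rightarrow> 'a set \<Rightarrow> 'a \<Rightarrow> bool" where
  "pseudo_discrete G T E g \<longleftrightarrow>
     E \<noteq> identity_component G T \<and> g \<in> carrier G \<and>
     g <#\<^bsub>G\<^esub> (identity_component G T - E) \<subseteq> E"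

section \<open>The point symmetry group of the Burgers equation\<close>

type_synonym parameters = "real \<times> real \<times> real \<times> real \<times> real \<times> real"

definition burgers_parameters :: "parameters set" where
  "burgers_parameters = {(\<alpha>, \<beta>, \<gamma>, \<delta>, l1, l0). \<alpha> * \<delta> - \<beta> * \<gamma> = 1}"

fun burgers_map :: "parameters \<Rightarrow> transformation" where
  "burgers_map (\<alpha>, \<beta>, \<gamma>, \<delta>, l1, l0) (t, x, v) =
     (if \<gamma> * t + \<delta> \<noteq> 0
      then Some ((\<alpha> * t + \<beta>) / (\<gamma> * t + \<delta>),
                 (x + l1 * t + l0) / (\<gamma> * t + \<delta>),
                 (\<gamma> * t + \<delta>) * v - \<gamma> * x + l1 * \<delta> - l0 * \<gamma>)
      else None)"

definition burgers_transformations :: "transformation set" where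
  "burgers_transformations = burgers_map ` burgers_parameters"

text \<open>
  The usual composition \<open>\<Phi>\<^sub>1 \<circ>\<^sub>m \<Phi>\<^sub>2\<close> may have a smaller domain than the natural one.
  The modified composition is its unique extension to a transformation
  from \<open>burgers_transformations\<close>; see \<open>burgers_mult_map\<close> below for the parameters.
\<close>

definition burgers_mult :: "transformation \<Rightarrow> transformation \<Rightarrow> transformation" where
  "burgers_mult \<Phi>1 \<Phi>2 = (THE \<Phi>. \<Phi> \<in> burgers_transformations \<and> (\<Phi>1 \<circ>\<^sub>m \<Phi>2) \<subseteq>\<^sub>m \<Phi>)"

definition burgers_group :: "transformation monoid" where
  "burgers_group = \<lparr>carrier = burgers_transformations, mult = burgers_mult, one = Some\<rparr>"

text \<open>
  The topology that makes the parametrization a homeomorphism from the parameter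
  manifold in \<open>\<real>\<^sup>6\<close>.
\<close>

definition burgers_topology :: "transformation topology" where
  "burgers_topology =
     pullback_topology burgers_transformations
       (the_inv_into burgers_parameters burgers_map) euclidean"

text \<open>
  A vector field \<open>a \<partial>\<^sub>t + b \<partial>\<^sub>x + c \<partial>\<^sub>v\<close> is represented by
  the function \<open>(t, x, v) \<mapsto> (a, b, c)\<close>.
\<close>

definition burgers_algebra :: "(point \<Rightarrow> point) set" where
  "burgers_algebra =
     {(\<lambda>(t, x, v). c1 *\<^sub>R (1, 0, 0) + c2 *\<^sub>R (2 * t, x, - v) + c3 *\<^sub>R (t\<^sup>2, t * x, x - t * v)
                   + c4 *\<^sub>R (0, 1, 0) + c5 *\<^sub>R (0, t, 1)) | c1 c2 c3 c4 c5. True}"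

abbreviation burgers_exp_image :: "transformation set" where
  "burgers_exp_image \<equiv> exp_image burgers_group burgers_topology burgers_algebra"

definition J_breve :: transformation where
  "J_breve = (\<lambda>(t, x, v). Some (t, - x, - v))"

section \<open>Well-definedness of the group\<close>

lemma affine_eq:
  fixes a b c d s t :: real
  assumes "s \<noteq> t" "a * s + b = c * s + d" "a * t + b = c * t + d"
  shows "a = c \<and> b = d"
proof -
  have "(a - c) * (s - t) = 0" using assms by (simp add: algebra_simps)
  then show ?thesis using assms by simp
qed

lemma finite_poles: "a * d - b * c = 1 \<Longrightarrow> finite {t :: real. c * t + d = 0}"
proof (cases "c = 0")
  case False
  then have "{t. c * t + d = 0} \<subseteq> {- d / c}" by (auto simp: field_simps)
  then show ?thesis by (rule finite_subset) simp
qed auto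

text \<open>A transformation is determined by its values off finitely many times.\<close>

lemma burgers_map_determined:
  assumes p: "p \<in> burgers_parameters" and q: "q \<in> burgers_parameters" and F: "finite F"
    and eq: "\<And>t x v. t \<notin> F \<Longrightarrow> burgers_map p (t, x, v) = burgers_map q (t, x, v)"
  shows "p = q"
proof -
  obtain a b c d l m where pe: "p = (a, b, c, d, l, m)" by (cases p) auto
  obtain a' b' c' d' l' m' where qe: "q = (a', b', c', d', l', m')" by (cases q) auto
  define F' where "F' = F \<union> {t. c * t + d = 0} \<union> {t. c' * t + d' = 0}"
  have "finite F'"
    using p q F finite_poles[of a d b c] finite_poles[of a' d' b' c']
    by (simp add: F'_def burgers_parameters_def pe qe)
  then have inf: "infinite (- F')" by (simp add: finite_compl infinite_UNIV_char_0)
  then obtain s where s: "s \<in> - F'" by (metis finite.emptyI all_not_in_conv)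
  from inf have "infinite (- F' - {s})" by simp
  then obtain r where r: "r \<in> - F' - {s}" by (metis finite.emptyI all_not_in_conv)
  have lin: "c * t + d = c' * t + d' \<and> a * t + b = a' * t + b' \<and> l * t + m = l' * t + m'"
    if t: "t \<in> - F'" for t
  proof -
    have nz: "c * t + d \<noteq> 0" "c' * t + d' \<noteq> 0" and tF: "t \<notin> F" using t by (auto simp: F'_def)
    have e0: "(l * t + m) / (c * t + d) = (l' * t + m') / (c' * t + d')"
      using eq[OF tF, of 0 0] nz by (simp add: pe qe)
    have e1: "(1 + l * t + m) / (c * t + d) = (1 + l' * t + m') / (c' * t + d')"
      using eq[OF tF, of 1 0] nz by (simp add: pe qe)
    have e2: "(a * t + b) / (c * t + d) = (a' * t + b') / (c' * t + d')"
      using eq[OF tF, of 0 0] nz by (simp add: pe qe)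
    have "1 / (c * t + d) = 1 / (c' * t + d')"
      using e0 e1 unfolding add_divide_distrib by linarith
    then have "c * t + d = c' * t + d'" using nz by simp
    then show ?thesis using e0 e2 nz by simp
  qed
  have sr: "s \<noteq> r" and r': "r \<in> - F'" using r by auto
  note ls = lin[OF s] and lr = lin[OF r']
  have "c = c' \<and> d = d'" by (rule affine_eq[OF sr]) (use ls lr in blast)+
  moreover have "a = a' \<and> b = b'" by (rule affine_eq[OF sr]) (use ls lr in blast)+
  moreover have "l = l' \<and> m = m'" by (rule affine_eq[OF sr]) (use ls lr in blast)+
  ultimately show ?thesis by (simp add: pe qe)
qed

lemma inj_on_burgers_map: "inj_on burgers_map burgers_parameters"
  by (rule inj_onI, rule burgers_map_determined[where F = "{}"]) auto

fun mult_parameters :: "parameters \<Rightarrow> parameters \<Rightarrow> parameters" where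
  "mult_parameters (a, b, c, d, l, m) (a', b', c', d', l', m') =
     (a * a' + b * c', a * b' + b * d', c * a' + d * c', c * b' + d * d',
      l' + l * a' + m * c', m' + l * b' + m * d')"

lemma mult_parameters_closed:
  assumes "p \<in> burgers_parameters" "q \<in> burgers_parameters"
  shows "mult_parameters p q \<in> burgers_parameters"
proof -
  obtain a b c d l m where pe: "p = (a, b, c, d, l, m)" by (cases p) auto
  obtain a' b' c' d' l' m' where qe: "q = (a', b', c', d', l', m')" by (cases q) auto
  have "(a * a' + b * c') * (c * b' + d * d') - (a * b' + b * d') * (c * a' + d * c')
        = (a * d - b * c) * (a' * d' - b' * c')" by algebra
  then show ?thesis using assms by (simp add: burgers_parameters_def pe qe)
qed

lemma burgers_map_comp:
  assumes q: "q \<in> burgers_parameters"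
  shows "(burgers_map p \<circ>\<^sub>m burgers_map q) \<subseteq>\<^sub>m burgers_map (mult_parameters p q)"
proof -
  obtain a b c d l m where pe: "p = (a, b, c, d, l, m)" by (cases p) auto
  obtain a' b' c' d' l' m' where qe: "q = (a', b', c', d', l', m')" by (cases q) auto
  have det: "a' * d' - b' * c' = 1" using q by (simp add: burgers_parameters_def qe)
  have "burgers_map (mult_parameters p q) (t, x, v) = Some z"
    if z: "(burgers_map p \<circ>\<^sub>m burgers_map q) (t, x, v) = Some z" for t x v z
  proof -
    define k where "k = c' * t + d'"
    define n where "n = c * (a' * t + b') + d * k"
    have k: "k \<noteq> 0" using z by (auto simp: map_comp_def qe k_def split: if_splits)
    have den: "c * (a' * t + b') / k + d = n / k" using k by (simp add: n_def field_simps)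
    have n: "n \<noteq> 0"
      using z k by (simp add: map_comp_def qe pe k_def[symmetric] den split: if_splits)
    have nd: "(c * a' + d * c') * t + (c * b' + d * d') = n"
      by (simp add: n_def k_def algebra_simps)
    have zz: "z = ((a * ((a' * t + b') / k) + b) / (n / k),
        ((x + l' * t + m') / k + l * ((a' * t + b') / k) + m) / (n / k),
        n / k * (k * v - c' * x + l' * d' - m' * c') - c * ((x + l' * t + m') / k) + l * d - m * c)"
      using z k n by (simp add: map_comp_def qe pe k_def[symmetric] den)
    have "(a * (P / k) + b) / (n / k) = (a * P + b * k) / n" for P
      using k n by (simp add: field_simps)
    moreover have "a * (a' * t + b') + b * k = (a * a' + b * c') * t + (a * b' + b * d')"
      unfolding k_def by algebra
    ultimately have 1: "(a * ((a' * t + b') / k) + b) / (n / k)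
        = ((a * a' + b * c') * t + (a * b' + b * d')) / n" by (simp only:)
    have "(Q / k + l * (P / k) + m) / (n / k) = (Q + l * P + m * k) / n" for P Q
      using k n by (simp add: field_simps)
    moreover have "x + l' * t + m' + l * (a' * t + b') + m * k
        = x + (l' + l * a' + m * c') * t + (m' + l * b' + m * d')"
      unfolding k_def by algebra
    ultimately have 2: "((x + l' * t + m') / k + l * ((a' * t + b') / k) + m) / (n / k)
        = (x + (l' + l * a' + m * c') * t + (m' + l * b' + m * d')) / n" by (simp only:)
    have "k * (n / k * (k * v - c' * x + l' * d' - m' * c') - c * ((x + l' * t + m') / k) + l * d - m * c)
       = n * (k * v - c' * x + l' * d' - m' * c') - c * (x + l' * t + m') + k * (l * d - m * c)"
    proof -
      have "k * (n / k * V - c * (Q / k) + l * d - m * c) = n * V - c * Q + k * (l * d - m * c)"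
        for V Q using k by (simp add: field_simps)
      then show ?thesis .
    qed
    also have "\<dots> = k * (n * v - (c * a' + d * c') * x
          + (l' + l * a' + m * c') * (c * b' + d * d') - (m' + l * b' + m * d') * (c * a' + d * c'))"
      using det unfolding n_def k_def by algebra
    finally have 3: "n / k * (k * v - c' * x + l' * d' - m' * c') - c * ((x + l' * t + m') / k) + l * d - m * c
       = n * v - (c * a' + d * c') * x
          + (l' + l * a' + m * c') * (c * b' + d * d') - (m' + l * b' + m * d') * (c * a' + d * c')"
      using k by simp
    show ?thesis unfolding zz 1 2 3 pe qe using n by (simp add: nd)
  qed
  then show ?thesis unfolding map_le_def by auto
qed

lemma burgers_mult_map:
  assumes p: "p \<in> burgers_parameters" and q: "q \<in> burgers_parameters"
  shows "burgers_mult (burgers_map p) (burgers_map q) = burgers_map (mult_parameters p q)"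
  unfolding burgers_mult_def
proof (rule the_equality)
  show "burgers_map (mult_parameters p q) \<in> burgers_transformations \<and>
      (burgers_map p \<circ>\<^sub>m burgers_map q) \<subseteq>\<^sub>m burgers_map (mult_parameters p q)"
    using mult_parameters_closed[OF p q] burgers_map_comp[OF q]
    by (simp add: burgers_transformations_def)
next
  fix \<Phi>
  assume \<Phi>: "\<Phi> \<in> burgers_transformations \<and> (burgers_map p \<circ>\<^sub>m burgers_map q) \<subseteq>\<^sub>m \<Phi>"
  then obtain r where r: "r \<in> burgers_parameters" "\<Phi> = burgers_map r"
    by (auto simp: burgers_transformations_def)
  obtain a b c d l m where pe: "p = (a, b, c, d, l, m)" by (cases p) auto
  obtain a' b' c' d' l' m' where qe: "q = (a', b', c', d', l', m')" by (cases q) auto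
  define F where "F = {t. c' * t + d' = 0} \<union> {t. (c * a' + d * c') * t + (c * b' + d * d') = 0}"
  have "finite F"
    using q mult_parameters_closed[OF p q] finite_poles[of a' d' b' c']
      finite_poles[of "a * a' + b * c'" "c * b' + d * d'" "a * b' + b * d'" "c * a' + d * c'"]
    by (simp add: F_def burgers_parameters_def pe qe)
  moreover have "burgers_map r (t, x, v) = burgers_map (mult_parameters p q) (t, x, v)"
    if "t \<notin> F" for t x v
  proof -
    have k: "c' * t + d' \<noteq> 0" using that by (auto simp: F_def)
    have "c * ((a' * t + b') / (c' * t + d')) + d
        = ((c * a' + d * c') * t + (c * b' + d * d')) / (c' * t + d')"
      using k by (simp add: field_simps)
    then have "c * ((a' * t + b') / (c' * t + d')) + d \<noteq> 0"
      using k that by (simp add: F_def)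
    then have "(t, x, v) \<in> dom (burgers_map p \<circ>\<^sub>m burgers_map q)"
      using k by (simp add: dom_def map_comp_def pe qe)
    then show ?thesis
      using \<Phi> r burgers_map_comp[OF q, of p] unfolding map_le_def by (metis)
  qed
  ultimately have "r = mult_parameters p q"
    using burgers_map_determined r(1) mult_parameters_closed[OF p q] by blast
  then show "\<Phi> = burgers_map (mult_parameters p q)" using r by simp
qed

lemma burgers_map_one: "burgers_map (1, 0, 0, 1, 0, 0) = Some"
  by (rule ext) auto

lemma group_burgers_group: "group burgers_group"
proof (rule groupI)
  show "\<one>\<^bsub>burgers_group\<^esub> \<in> carrier burgers_group"
    by (auto simp: burgers_group_def burgers_transformations_def burgers_parameters_def
        burgers_map_one[symmetric])
next
  fix x y assume "x \<in> carrier burgers_group" "y \<in> carrier burgers_group"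
  then obtain p q where "p \<in> burgers_parameters" "q \<in> burgers_parameters"
      "x = burgers_map p" "y = burgers_map q"
    by (auto simp: burgers_group_def burgers_transformations_def)
  then show "x \<otimes>\<^bsub>burgers_group\<^esub> y \<in> carrier burgers_group"
    by (simp add: burgers_group_def burgers_transformations_def burgers_mult_map
        mult_parameters_closed)
next
  fix x y z
  assume "x \<in> carrier burgers_group" "y \<in> carrier burgers_group" "z \<in> carrier burgers_group"
  then obtain p q r where pqr: "p \<in> burgers_parameters" "q \<in> burgers_parameters"
      "r \<in> burgers_parameters" "x = burgers_map p" "y = burgers_map q" "z = burgers_map r"
    by (auto simp: burgers_group_def burgers_transformations_def)
  have "mult_parameters (mult_parameters p q) r = mult_parameters p (mult_parameters q r)"
    by (cases p; cases q; cases r) (auto simp: algebra_simps)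
  then show "x \<otimes>\<^bsub>burgers_group\<^esub> y \<otimes>\<^bsub>burgers_group\<^esub> z = x \<otimes>\<^bsub>burgers_group\<^esub> (y \<otimes>\<^bsub>burgers_group\<^esub> z)"
    using pqr by (simp add: burgers_group_def burgers_mult_map mult_parameters_closed)
next
  fix x assume "x \<in> carrier burgers_group"
  then obtain p where p: "p \<in> burgers_parameters" "x = burgers_map p"
    by (auto simp: burgers_group_def burgers_transformations_def)
  have one: "(1, 0, 0, 1, 0, 0) \<in> burgers_parameters" by (simp add: burgers_parameters_def)
  have "mult_parameters (1, 0, 0, 1, 0, 0) p = p" by (cases p) auto
  then show "\<one>\<^bsub>burgers_group\<^esub> \<otimes>\<^bsub>burgers_group\<^esub> x = x"
    using burgers_mult_map[OF one p(1)] p(2) by (simp add: burgers_group_def burgers_map_one)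
  obtain a b c d l m where pe: "p = (a, b, c, d, l, m)" by (cases p) auto
  have det: "a * d - b * c = 1" using p by (simp add: burgers_parameters_def pe)
  define q where "q = (d, - b, - c, a, m * c - l * d, l * b - m * a)"
  have q: "q \<in> burgers_parameters" using det by (simp add: burgers_parameters_def q_def algebra_simps)
  have "l + (m * c - l * d) * a + (l * b - m * a) * c = 0"
       "m + (m * c - l * d) * b + (l * b - m * a) * d = 0" using det by algebra+
  then have "mult_parameters q p = (1, 0, 0, 1, 0, 0)"
    using det by (simp add: q_def pe algebra_simps)
  then have "burgers_mult (burgers_map q) x = Some"
    using burgers_mult_map[OF q p(1)] p(2) by (simp only: burgers_map_one)
  then show "\<exists>y\<in>carrier burgers_group. y \<otimes>\<^bsub>burgers_group\<^esub> x = \<one>\<^bsub>burgers_group\<^esub>"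
    using q by (auto simp: burgers_group_def burgers_transformations_def)
qed

end

theory Submission
  imports Defs
begin

text \<open>
  An element of the group is a matrix in \<open>SL(2, \<real>)\<close> together with a row vector \<open>(\<lambda>\<^sub>1, \<lambda>\<^sub>0)\<close>.
  If the trace of the matrix exceeds \<open>-2\<close>, the element lies on an explicit one-parameter
  subgroup \<open>s \<mapsto> (exp (s B), u \<integral>\<^sub>0\<^sup>s exp (\<tau> B) d\<tau>)\<close>.  Multiplication by \<open>\<J>\<close> changes the sign of the
  matrix, so for each \<open>g\<close> one of \<open>g\<close> and \<open>\<J> g\<close> is in the image of the exponential map.
  On the other hand, an element whose matrix is a nontrivial Jordan block with eigenvalue \<open>-1\<close>
  has no square root, so it is not in this image; it is joined to the identity by a curve.
\<close>

section \<open>Closed-form exponentials of traceless 2 by 2 matrices\<close>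

text \<open>
  If \<open>B\<^sup>2 = \<kappa> I\<close>, then \<open>exp (s B) = C s I + S s B\<close>, and the integral of this from \<open>0\<close> to \<open>s\<close>
  is \<open>S s I + D s B\<close>.
\<close>

locale exp_coefficients =
  fixes \<kappa> :: real and C S D :: "real \<Rightarrow> real"
  assumes deriv_C: "(C has_real_derivative \<kappa> * S s) (at s)"
    and deriv_S: "(S has_real_derivative C s) (at s)"
    and deriv_D: "(D has_real_derivative S s) (at s)"
    and zero: "C 0 = 1" "S 0 = 0" "D 0 = 0"
    and C_eq: "C s = 1 + \<kappa> * D s"
    and S_square: "(S s)\<^sup>2 = D s * (C s + 1)"
    and C_add: "C (r + s) = C r * C s + \<kappa> * S r * S s"
    and S_add: "S (r + s) = S r * C s + C r * S s"
    and D_add: "D (r + s) = D s + D r * C s + S r * S s"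

lemma exp_coefficients_elliptic:
  assumes "w \<noteq> 0"
  shows "exp_coefficients (- (w\<^sup>2)) (\<lambda>s. cos (w * s)) (\<lambda>s. sin (w * s) / w)
    (\<lambda>s. (1 - cos (w * s)) / w\<^sup>2)"
proof
  fix r s :: real
  have 1: "(sin (w * s))\<^sup>2 = 1 - (cos (w * s))\<^sup>2" by (simp add: sin_squared_eq)
  show "(sin (w * s) / w)\<^sup>2 = (1 - cos (w * s)) / w\<^sup>2 * (cos (w * s) + 1)"
    unfolding power_divide 1 by (simp add: algebra_simps power2_eq_square)
qed (use assms in \<open>auto intro!: derivative_eq_intros
      simp: cos_add sin_add field_simps power2_eq_square\<close>)

lemma exp_coefficients_hyperbolic:
  assumes "w \<noteq> 0"
  shows "exp_coefficients (w\<^sup>2) (\<lambda>s. cosh (w * s)) (\<lambda>s. sinh (w * s) / w)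
    (\<lambda>s. (cosh (w * s) - 1) / w\<^sup>2)"
proof
  fix r s :: real
  have 1: "(sinh (w * s))\<^sup>2 = (cosh (w * s))\<^sup>2 - 1" by (simp add: cosh_square_eq)
  show "(sinh (w * s) / w)\<^sup>2 = (cosh (w * s) - 1) / w\<^sup>2 * (cosh (w * s) + 1)"
    unfolding power_divide 1 by (simp add: algebra_simps power2_eq_square)
qed (use assms in \<open>auto intro!: derivative_eq_intros
      simp: cosh_add sinh_add field_simps power2_eq_square\<close>)

lemma exp_coefficients_parabolic: "exp_coefficients 0 (\<lambda>s. 1) (\<lambda>s. s) (\<lambda>s. s\<^sup>2 / 2)"
  by unfold_locales (auto intro!: derivative_eq_intros simp: field_simps power2_eq_square)

text \<open>Here \<open>c\<close> stands for half the trace of a matrix to be written as exp B.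
  Comparing \<open>c\<close> with 1 selects the elliptic, parabolic or hyperbolic type. B and its
  row vector are later found by dividing by \<open>S 1\<close> and \<open>D 1\<close>, so both must
  be nonzero.\<close>

lemma exp_coefficients_exist:
  assumes "c > - 1"
  obtains \<kappa> C S D where "exp_coefficients \<kappa> C S D" "C 1 = c" "S 1 \<noteq> 0" "D 1 \<noteq> 0"
proof -
  consider "c < 1" | "c = 1" | "c > 1" by linarith
  then show thesis
  proof cases
    case 1
    define w where "w = arccos c"
    have cw: "cos w = c" using 1 assms by (simp add: w_def)
    \<comment> \<open>The bound \<open>c > - 1\<close> matters here: at \<open>w = pi\<close> the
      sine, and with it \<open>S 1\<close>, would vanish.\<close>
    have "0 < w" "w < pi" using 1 assms arccos_lt_bounded[of c] by (auto simp: w_def)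
    moreover from this have "sin w > 0" by (rule sin_gt_zero)
    ultimately show thesis using 1 cw that[OF exp_coefficients_elliptic[of w]] by simp
  next
    case 2
    then show thesis using that[OF exp_coefficients_parabolic] by simp
  next
    case 3
    define w where "w = arcosh c"
    have cw: "cosh w = c" using 3 by (simp add: w_def)
    then have "w \<noteq> 0" using 3 by auto
    then show thesis using 3 cw that[OF exp_coefficients_hyperbolic[of w]] by simp
  qed
qed

section \<open>One-parameter subgroups through elements of trace above -2\<close>

lemma continuous_map_burgers_map:
  assumes "\<And>s. P s \<in> burgers_parameters" and "continuous_on UNIV P"
  shows "continuous_map euclideanreal burgers_topology (\<lambda>s. burgers_map (P s))"
  unfolding burgers_topology_def
proof (rule continuous_map_pullback')
  have "the_inv_into burgers_parameters burgers_map \<circ> (\<lambda>s. burgers_map (P s)) = P"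
    using assms(1) by (auto simp: the_inv_into_f_f[OF inj_on_burgers_map])
  then show "continuous_map euclideanreal euclidean
      (the_inv_into burgers_parameters burgers_map \<circ> (\<lambda>s. burgers_map (P s)))"
    using assms(2) by simp
qed (use assms(1) in \<open>auto simp: burgers_transformations_def\<close>)

text \<open>Half the trace fixes \<open>C 1\<close>. The matrix equation
  \<open>C 1 I + S 1 B = A\<close> then determines B, and the row vector equation is solvable
  because \<open>S 1 I + D 1 B\<close> is invertible.\<close>

lemma trace_gt_imp_exp_image:
  assumes p: "(a, b, c, d, l, m) \<in> burgers_parameters" and trace: "a + d > - 2"
  shows "burgers_map (a, b, c, d, l, m) \<in> burgers_exp_image"
proof -
  have det: "a * d - b * c = 1" using p by (simp add: burgers_parameters_def)
  obtain \<kappa> C S D where "exp_coefficients \<kappa> C S D"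
    and C1: "C 1 = (a + d) / 2" and S1: "S 1 \<noteq> 0" and D1: "D 1 \<noteq> 0"
    by (rule exp_coefficients_exist[of "(a + d) / 2"]) (use trace in auto)
  then interpret exp_coefficients \<kappa> C S D by simp
  \<comment> \<open>This amounts to det exp (s B) = 1.\<close>
  have CS: "(C s)\<^sup>2 - \<kappa> * (S s)\<^sup>2 = 1" for s
    using C_eq[of s] S_square[of s] by algebra
  \<comment> \<open>B has rows (\<open>h\<close>, \<open>e\<close>) and (\<open>f\<close>,
    \<open>- h\<close>): the traceless part of A divided by \<open>S 1\<close>.\<close>
  define h e f where "h = (a - d) / (2 * S 1)" and "e = b / S 1" and "f = c / S 1"
  have hef: "h * S 1 = (a - d) / 2" "e * S 1 = b" "f * S 1 = c"
    using S1 by (auto simp: h_def e_def f_def)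
  have "(h\<^sup>2 + e * f - \<kappa>) * (S 1)\<^sup>2 = (h * S 1)\<^sup>2 + (e * S 1) * (f * S 1) - \<kappa> * (S 1)\<^sup>2"
    by algebra
  also have "\<dots> = 0"
    unfolding hef using CS[of 1] det C1 by (simp add: power2_eq_square field_simps)
  finally have B: "h\<^sup>2 + e * f = \<kappa>" using S1 by simp
  \<comment> \<open>The row (\<open>u\<close>, \<open>w\<close>) is (\<open>l\<close>,
    \<open>m\<close>) times the adjugate of \<open>S 1 I + D 1 B\<close>, divided by its determinant
    \<open>2 * D 1\<close>.\<close>
  define u where "u = (l * (S 1 - D 1 * h) - m * D 1 * f) / (2 * D 1)"
  define w where "w = (m * (S 1 + D 1 * h) - l * D 1 * e) / (2 * D 1)"
  have u: "2 * D 1 * u = l * (S 1 - D 1 * h) - m * D 1 * f"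
    and w: "2 * D 1 * w = m * (S 1 + D 1 * h) - l * D 1 * e"
    using D1 by (simp_all add: u_def w_def)
  define P where "P s = (C s + S s * h, S s * e, S s * f, C s - S s * h,
      u * (S s + D s * h) + w * D s * f, u * D s * e + w * (S s - D s * h))" for s
  have P: "P s \<in> burgers_parameters" for s
  proof -
    have "(C s + S s * h) * (C s - S s * h) - S s * e * (S s * f) = 1"
      using CS[of s] B by algebra
    then show ?thesis by (simp add: P_def burgers_parameters_def)
  qed
  \<comment> \<open>For the row vectors this is a cocycle rule: the integral up to r + s is the
    integral up to s plus the integral up to r times exp (s B).\<close>
  have P_add: "P (r + s) = mult_parameters (P r) (P s)" for r s
  proof -
    note add = C_add[of r s] S_add[of r s] D_add[of r s] C_eq[of r]
    have "C (r + s) + S (r + s) * h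
        = (C r + S r * h) * (C s + S s * h) + S r * e * (S s * f)" using add B by algebra
    moreover have "S (r + s) * e
        = (C r + S r * h) * (S s * e) + S r * e * (C s - S s * h)" using add by algebra
    moreover have "S (r + s) * f
        = S r * f * (C s + S s * h) + (C r - S r * h) * (S s * f)" using add by algebra
    moreover have "C (r + s) - S (r + s) * h
        = S r * f * (S s * e) + (C r - S r * h) * (C s - S s * h)" using add B by algebra
    moreover have "u * (S (r + s) + D (r + s) * h) + w * D (r + s) * f
        = u * (S s + D s * h) + w * D s * f
          + (u * (S r + D r * h) + w * D r * f) * (C s + S s * h)
          + (u * D r * e + w * (S r - D r * h)) * (S s * f)" using add B by algebra
    moreover have "u * D (r + s) * e + w * (S (r + s) - D (r + s) * h)
        = u * D s * e + w * (S s - D s * h)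
          + (u * (S r + D r * h) + w * D r * f) * (S s * e)
          + (u * D r * e + w * (S r - D r * h)) * (C s - S s * h)" using add B by algebra
    ultimately show ?thesis unfolding P_def mult_parameters.simps by (simp only:)
  qed
  have P1: "P 1 = (a, b, c, d, l, m)"
  proof -
    \<comment> \<open>The matrix \<open>S 1 I + D 1 B\<close> has determinant \<open>2 D 1\<close>.\<close>
    have F: "(S 1)\<^sup>2 - \<kappa> * (D 1)\<^sup>2 = 2 * D 1" using S_square[of 1] C_eq[of 1] by algebra
    have nz: "2 * D 1 \<noteq> 0" using D1 by simp
    have "2 * D 1 * (u * (S 1 + D 1 * h) + w * D 1 * f) = 2 * D 1 * l"
      using u w F B by algebra
    then have 1: "u * (S 1 + D 1 * h) + w * D 1 * f = l"
      by (rule mult_left_cancel[OF nz, THEN iffD1])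
    have "2 * D 1 * (u * D 1 * e + w * (S 1 - D 1 * h)) = 2 * D 1 * m"
      using u w F B by algebra
    then have 2: "u * D 1 * e + w * (S 1 - D 1 * h) = m"
      by (rule mult_left_cancel[OF nz, THEN iffD1])
    have 3: "S 1 * e = b" "S 1 * f = c"
      using S1 by (simp_all add: e_def f_def)
    have "S 1 * h = (a - d) / 2" using S1 by (simp add: h_def)
    then have 4: "C 1 + S 1 * h = a" "C 1 - S 1 * h = d"
      using C1 by argo+
    show ?thesis unfolding P_def 1 2 3 4 ..
  qed
  define \<phi> where "\<phi> s = burgers_map (P s)" for s
  have cont: "continuous_on UNIV C" "continuous_on UNIV S" "continuous_on UNIV D"
    using deriv_C deriv_S deriv_D by (meson DERIV_continuous_on DERIV_subset subset_UNIV)+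
  have "continuous_on UNIV P" unfolding P_def by (intro continuous_intros cont)
  with P have "continuous_map euclideanreal burgers_topology \<phi>"
    unfolding \<phi>_def by (rule continuous_map_burgers_map)
  moreover have "\<phi> (r + s) = \<phi> r \<otimes>\<^bsub>burgers_group\<^esub> \<phi> s" for r s
    by (simp add: \<phi>_def P_add burgers_mult_map[OF P P] burgers_group_def)
  ultimately have "one_parameter_subgroup burgers_group burgers_topology \<phi>"
    by (simp add: one_parameter_subgroup_def)
  \<comment> \<open>At s = 0 the parameters have derivatives (\<open>h\<close>, \<open>e\<close>,
    \<open>f\<close>, \<open>- h\<close>, \<open>u\<close>, \<open>w\<close>). The lower left entry
    acts through the denominator, hence the sign of \<open>f\<close>.\<close>
  define Q :: "point \<Rightarrow> point" where
    "Q = (\<lambda>(t, x, v). e *\<^sub>R (1, 0, 0) + h *\<^sub>R (2 * t, x, - v)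
      + (- f) *\<^sub>R (t\<^sup>2, t * x, x - t * v) + w *\<^sub>R (0, 1, 0) + u *\<^sub>R (0, t, 1))"
  have "Q \<in> burgers_algebra" unfolding Q_def burgers_algebra_def by blast
  moreover have "generated_by \<phi> Q"
    unfolding generated_by_def
  proof (intro allI)
    fix z :: point
    obtain t x v where z: "z = (t, x, v)" by (cases z) auto
    define k where "k s = S s * f * t + (C s - S s * h)" for s
    define L M where "L s = u * (S s + D s * h) + w * D s * f"
      and "M s = u * D s * e + w * (S s - D s * h)" for s
    \<comment> \<open>At a fixed point \<open>\<phi> s\<close> may be undefined for some s, but the
      denominator \<open>k\<close> is 1 at 0 and so nonzero nearby.\<close>
    have "continuous_on UNIV k" unfolding k_def by (intro continuous_intros cont)
    then have "open {s. k s \<noteq> 0}" by (intro open_Collect_neq continuous_on_const)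
    moreover have k0: "k 0 = 1" by (simp add: k_def zero)
    ultimately have "\<forall>\<^sub>F s in nhds 0. k s \<noteq> 0"
      using eventually_nhds_in_open[of "{s. k s \<noteq> 0}" 0] by simp
    then have ev: "\<forall>\<^sub>F s in nhds 0. z \<in> dom (\<phi> s) \<and> the (\<phi> s z) =
        (((C s + S s * h) * t + S s * e) / k s, (x + L s * t + M s) / k s,
         k s * v - S s * f * x + L s * (C s - S s * h) - M s * (S s * f))"
      by eventually_elim (simp add: dom_def z \<phi>_def P_def k_def L_def M_def)
    note D0 = deriv_C[of 0, unfolded zero mult_zero_right] deriv_S[of 0, unfolded zero]
      deriv_D[of 0, unfolded zero]
    have dk: "(k has_real_derivative f * t - h) (at 0)"
      unfolding k_def by (auto intro!: derivative_eq_intros D0 simp: zero)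
    have dL: "(L has_real_derivative u) (at 0)" and dM: "(M has_real_derivative w) (at 0)"
      unfolding L_def M_def by (auto intro!: derivative_eq_intros D0 simp: zero)
    have L0: "L 0 = 0" and M0: "M 0 = 0" by (simp_all add: L_def M_def zero)
    note at0 = zero k0 L0 M0
    have "((\<lambda>s. ((C s + S s * h) * t + S s * e) / k s) has_real_derivative
        e + h * (2 * t) - f * t\<^sup>2) (at 0)"
      by (rule derivative_eq_intros D0 dk refl)+ (simp_all add: at0 algebra_simps power2_eq_square)
    moreover have "((\<lambda>s. (x + L s * t + M s) / k s) has_real_derivative
        h * x - f * (t * x) + w + u * t) (at 0)"
      by (rule derivative_eq_intros dk dL dM refl)+ (simp_all add: at0 algebra_simps)
    moreover have "((\<lambda>s. k s * v - S s * f * x + L s * (C s - S s * h) - M s * (S s * f))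
        has_real_derivative - (h * v) - f * (x - t * v) + u) (at 0)"
      by (rule derivative_eq_intros D0 dk dL dM refl)+ (simp_all add: at0 algebra_simps)
    ultimately have "((\<lambda>s. (((C s + S s * h) * t + S s * e) / k s, (x + L s * t + M s) / k s,
         k s * v - S s * f * x + L s * (C s - S s * h) - M s * (S s * f)))
        has_vector_derivative Q z) (at 0)"
      by (auto simp: Q_def z has_real_derivative_iff_has_vector_derivative
          intro!: has_vector_derivative_Pair elim: has_vector_derivative_eq_rhs)
    moreover have "((\<lambda>s. the (\<phi> s z)) has_vector_derivative Q z) (at 0) \<longleftrightarrow>
        ((\<lambda>s. (((C s + S s * h) * t + S s * e) / k s, (x + L s * t + M s) / k s,
         k s * v - S s * f * x + L s * (C s - S s * h) - M s * (S s * f)))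
        has_vector_derivative Q z) (at 0)"
      by (rule has_vector_derivative_cong_ev)
        (use ev eventually_nhds_x_imp_x[OF ev] in \<open>auto elim: eventually_mono\<close>)
    ultimately have "((\<lambda>s. the (\<phi> s z)) has_vector_derivative Q z) (at 0)" by simp
    then show "(\<forall>\<^sub>F s in nhds 0. z \<in> dom (\<phi> s))
        \<and> ((\<lambda>s. the (\<phi> s z)) has_vector_derivative Q z) (at 0)"
      using ev by (auto elim: eventually_mono)
  qed
  ultimately have "\<phi> 1 \<in> burgers_exp_image"
    using \<open>one_parameter_subgroup burgers_group burgers_topology \<phi>\<close>
    unfolding exp_image_def by blast
  then show ?thesis by (simp add: \<phi>_def P1)
qed

section \<open>An element of the identity component outside the exponential image\<close>

lemma topspace_burgers_topology: "topspace burgers_topology = burgers_transformations"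
  by (simp add: burgers_topology_def topspace_pullback_topology)

text \<open>The value at time 1/2 is a square root, which gives an algebraic obstruction to being an
  exponential.\<close>

lemma exp_image_square:
  assumes "g \<in> burgers_exp_image"
  obtains q where "q \<in> burgers_parameters" "g = burgers_map (mult_parameters q q)"
proof -
  obtain \<phi> where g: "g = \<phi> 1" and cont: "continuous_map euclideanreal burgers_topology \<phi>"
    and add: "\<And>r s. \<phi> (r + s) = burgers_mult (\<phi> r) (\<phi> s)"
    using assms by (auto simp: exp_image_def one_parameter_subgroup_def burgers_group_def)
  have "\<phi> (1 / 2) \<in> burgers_transformations"
    using continuous_map_image_subset_topspace[OF cont] by (auto simp: topspace_burgers_topology)
  then obtain q where q: "q \<in> burgers_parameters" "\<phi> (1 / 2) = burgers_map q"
    by (auto simp: burgers_transformations_def)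
  have "g = burgers_map (mult_parameters q q)"
    using add[of "1 / 2" "1 / 2"] q g burgers_mult_map[OF q(1) q(1)] by simp
  with q(1) show thesis by (rule that)
qed

text \<open>By the Cayley--Hamilton theorem, \<open>-I\<close> is the only square of trace \<open>-2\<close> in \<open>SL(2, \<real>)\<close>.\<close>

lemma jordan_block_notin_exp_image:
  assumes "b \<noteq> 0"
  shows "burgers_map (- 1, b, 0, - 1, l, m) \<notin> burgers_exp_image"
proof
  assume "burgers_map (- 1, b, 0, - 1, l, m) \<in> burgers_exp_image"
  then obtain q where q: "q \<in> burgers_parameters"
    "burgers_map (- 1, b, 0, - 1, l, m) = burgers_map (mult_parameters q q)"
    by (rule exp_image_square)
  obtain a' b' c' d' l' m' where qe: "q = (a', b', c', d', l', m')" by (cases q) auto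
  have "(- 1, b, 0, - 1, l, m) = mult_parameters q q"
    using inj_onD[OF inj_on_burgers_map q(2)] mult_parameters_closed[OF q(1) q(1)]
    by (simp add: burgers_parameters_def)
  then have eq: "- 1 = a' * a' + b' * c'" "b = a' * b' + b' * d'" "- 1 = c' * b' + d' * d'"
    unfolding qe mult_parameters.simps prod.inject by blast+
  have "a' * d' - b' * c' = 1" using q(1) by (simp add: qe burgers_parameters_def)
  \<comment> \<open>For determinant 1, the trace of the square is the squared trace minus 2, and
    here it equals -2.\<close>
  then have "(a' + d')\<^sup>2 = 0" using eq by algebra
  then have "a' + d' = 0" by simp
  moreover have "b = b' * (a' + d')" using eq by algebra
  ultimately show False using assms by simp
qed

text \<open>Together with the preceding lemma this gives the condition of
  \<open>pseudo_discrete\<close> that the exponential image differs from the identity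
  component.\<close>

lemma jordan_block_in_identity_component:
  "burgers_map (- 1, pi, 0, - 1, 0, 0) \<in> identity_component burgers_group burgers_topology"
proof -
  \<comment> \<open>A rotation by \<open>s\<close> multiplied by a shear of size \<open>- s\<close>.\<close>
  define P :: "real \<Rightarrow> parameters" where
    "P s = (cos s, - s * cos s - sin s, sin s, cos s - s * sin s, 0, 0)" for s
  have P: "P s \<in> burgers_parameters" for s
  proof -
    have "cos s * (cos s - s * sin s) - (- s * cos s - sin s) * sin s = 1"
      using sin_cos_squared_add[of s] by algebra
    then show ?thesis by (simp add: P_def burgers_parameters_def)
  qed
  have "continuous_on UNIV P" unfolding P_def by (intro continuous_intros)
  with P have "continuous_map euclideanreal burgers_topology (\<lambda>s. burgers_map (P s))"
    by (rule continuous_map_burgers_map)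
  then have "connectedin burgers_topology (range (\<lambda>s. burgers_map (P s)))"
    by (rule connectedin_continuous_map_image) simp
  moreover have "P 0 = (1, 0, 0, 1, 0, 0)" "P pi = (- 1, pi, 0, - 1, 0, 0)"
    by (simp_all add: P_def)
  ultimately show ?thesis
    unfolding identity_component_def connected_component_of_def burgers_group_def
      burgers_map_one[symmetric]
    by (metis (mono_tags, lifting) mem_Collect_eq monoid.select_convs(2) rangeI)
qed

section \<open>Multiplication by the element with matrix -I\<close>

lemma J_breve_eq: "J_breve = burgers_map (- 1, 0, 0, - 1, 0, 0)"
  by (rule ext) (auto simp: J_breve_def)

text \<open>Outside the exponential image the trace is at most -2, so after the sign change it is at
  least 2.\<close>

lemma J_breve_coset:
  "J_breve <#\<^bsub>burgers_group\<^esub> (carrier burgers_group - burgers_exp_image) \<subseteq> burgers_exp_image"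
proof
  fix g assume "g \<in> J_breve <#\<^bsub>burgers_group\<^esub> (carrier burgers_group - burgers_exp_image)"
  then obtain p where p: "p \<in> burgers_parameters" "burgers_map p \<notin> burgers_exp_image"
    and g: "g = burgers_mult J_breve (burgers_map p)"
    by (auto simp: l_coset_def burgers_group_def burgers_transformations_def)
  obtain a b c d l m where pe: "p = (a, b, c, d, l, m)" by (cases p) auto
  have "\<not> a + d > - 2" using p trace_gt_imp_exp_image by (auto simp: pe)
  moreover have "(- a, - b, - c, - d, l, m) \<in> burgers_parameters"
    using p(1) by (simp add: pe burgers_parameters_def)
  moreover have "g = burgers_map (- a, - b, - c, - d, l, m)"
    using burgers_mult_map[OF _ p(1), of "(- 1, 0, 0, - 1, 0, 0)"]
    by (simp add: g J_breve_eq pe burgers_parameters_def)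
  ultimately show "g \<in> burgers_exp_image" using trace_gt_imp_exp_image by simp
qed

theorem corollary25:
  shows "J_breve \<in> carrier burgers_group
    \<and> J_breve <#\<^bsub>burgers_group\<^esub> (carrier burgers_group - burgers_exp_image) \<subseteq> burgers_exp_image
    \<and> pseudo_discrete burgers_group burgers_topology burgers_exp_image J_breve"
proof -
  have carrier: "J_breve \<in> carrier burgers_group"
    by (auto simp: J_breve_eq burgers_group_def burgers_transformations_def burgers_parameters_def)
  have "burgers_exp_image \<noteq> identity_component burgers_group burgers_topology"
    using jordan_block_in_identity_component jordan_block_notin_exp_image[of pi 0 0] by auto
  moreover have "identity_component burgers_group burgers_topology \<subseteq> carrier burgers_group"
    using connected_component_of_subset_topspace[of burgers_topology]
    by (simp add: identity_component_def topspace_burgers_topology burgers_group_def)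
  then have "J_breve <#\<^bsub>burgers_group\<^esub>
      (identity_component burgers_group burgers_topology - burgers_exp_image) \<subseteq> burgers_exp_image"
    using J_breve_coset unfolding l_coset_def by blast
  ultimately show ?thesis using carrier J_breve_coset by (simp add: pseudo_discrete_def)
qed

end
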